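(* Let $d,r\ge1$ and let $M\subset\mathcal{A}_d\otimes\mathbb{C}^r$ be a submodule that is generated by monomials. Then $M$ has the stable division property with respect to the $H^2$ norm. Moreover, the constant $C$ in the stable division property can be chosen to be $1$; that is, there is a finite set $\{f_1,\dots,f_k\}\subset M$ generating $M$ such that every $h\in M$ can be written $h=\sum_{i=1}^k a_if_i$ with $a_i\in\mathcal{A}_d$ and $\sum_{i=1}^k\|a_if_i\|^2\le\|h\|^2$.
   Context: $\mathcal{A}_d=\mathbb{C}[z_1,\dots,z_d]$. The $H^2$ inner product on $\mathcal{A}_d$ makes distinct monomials orthogonal with $\|z^\alpha\|^2=\frac{\alpha_1!\cdots\alpha_d!}{|\alpha|!}$. On $\mathcal{A}_d\otimes\mathbb{C}^r$ one uses the tensor product inner product with the standard inner product on $\mathbb{C}^r$. A monomial in $\mathcal{A}_d\otimes\mathbb{C}^r$ is an element of the form $z^\alpha\otimes\xi$ with $\alpha\in\mathbb{N}^d$ a multi-index and $\xi\in\mathbb{C}^r$ an arbitrary vector. A submodule $M$ of $\mathcal{A}_d\otimes\mathbb{C}^r$ has the stable division property if there are a finite set $\{f_1,\dots,f_k\}\subset M$ generating $M$ as an $\mathcal{A}_d$-module and a constant $C$ such that every $h\in M$ can be written $h=\sum_i a_if_i$ with $a_i\in\mathcal{A}_d$ and $\sum_i\|a_if_i\|^2\le C\|h\|^2$. *)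

theory Defs
  imports "HOL-Analysis.Analysis" "HOL-Library.Poly_Mapping"
begin

text \<open>Multi-indices in d variables are finitely supported functions on a finite type with d
  elements (here finite support is no restriction), and the product of the library type of
  finitely supported functions is the convolution, i.e. the product of polynomials.\<close>

type_synonym 'd mpoly = "('d \<Rightarrow>\<^sub>0 nat) \<Rightarrow>\<^sub>0 complex"

definition H2_weight :: "('d::finite \<Rightarrow>\<^sub>0 nat) \<Rightarrow> real" where
  "H2_weight \<alpha> = (\<Prod>j\<in>UNIV. fact (Poly_Mapping.lookup \<alpha> j))
     / fact (\<Sum>j\<in>UNIV. Poly_Mapping.lookup \<alpha> j)"

definition H2_inner :: "'d::finite mpoly \<Rightarrow> 'd mpoly \<Rightarrow> complex" where
  "H2_inner f g = (\<Sum>\<alpha>\<in>Poly_Mapping.keys f \<inter> Poly_Mapping.keys g.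
     Poly_Mapping.lookup f \<alpha> * cnj (Poly_Mapping.lookup g \<alpha>) * of_real (H2_weight \<alpha>))"

lemma H2_inner_monom:
  "H2_inner (Poly_Mapping.single \<alpha> 1) (Poly_Mapping.single \<beta> 1)
     = (if \<alpha> = \<beta> then of_real (H2_weight \<alpha>) else 0)"
  by (simp add: H2_inner_def)

text \<open>The tensor product of the polynomial ring with an r-dimensional coordinate space is
  represented by vectors of r polynomials; the lemma \<open>H2_vec_inner_pure_tensor\<close> below says that
  the inner product on it is the tensor product inner product.\<close>

definition pure_tensor :: "'d mpoly \<Rightarrow> complex ^ 'r \<Rightarrow> 'd mpoly ^ 'r" where
  "pure_tensor f \<xi> = (\<chi> i. Poly_Mapping.single 0 (\<xi> $ i) * f)"

definition H2_vec_inner :: "'d::finite mpoly ^ 'r \<Rightarrow> 'd mpoly ^ 'r \<Rightarrow> complex" where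
  "H2_vec_inner f g = (\<Sum>i\<in>UNIV. H2_inner (f $ i) (g $ i))"

definition H2_vec_norm :: "'d::finite mpoly ^ 'r \<Rightarrow> real" where
  "H2_vec_norm f = sqrt (Re (H2_vec_inner f f))"

lemma H2_inner_superset:
  assumes "finite A" "Poly_Mapping.keys f \<inter> Poly_Mapping.keys g \<subseteq> A"
  shows "H2_inner f g = (\<Sum>\<alpha>\<in>A.
     Poly_Mapping.lookup f \<alpha> * cnj (Poly_Mapping.lookup g \<alpha>) * of_real (H2_weight \<alpha>))"
  unfolding H2_inner_def using assms
  by (intro sum.mono_neutral_left) (auto simp: in_keys_iff)

lemma lookup_const_mult:
  fixes f :: "'d mpoly"
  shows "Poly_Mapping.lookup (Poly_Mapping.single 0 c * f) \<alpha> = c * Poly_Mapping.lookup f \<alpha>"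
proof -
  have "Poly_Mapping.single 0 c * f = Poly_Mapping.map ((*) c) f"
    using mult_map_scale_conv_mult[of c f] by simp
  then show ?thesis by (simp add: Poly_Mapping.map.rep_eq when_def)
qed

lemma H2_vec_inner_pure_tensor:
  "H2_vec_inner (pure_tensor f \<xi>) (pure_tensor g \<eta>)
     = H2_inner f g * (\<Sum>i\<in>UNIV. \<xi> $ i * cnj (\<eta> $ i))"
proof -
  let ?A = "Poly_Mapping.keys f \<inter> Poly_Mapping.keys g"
  have "H2_inner (Poly_Mapping.single 0 c * f) (Poly_Mapping.single 0 e * g)
      = H2_inner f g * (c * cnj e)" for c e
  proof -
    have "H2_inner (Poly_Mapping.single 0 c * f) (Poly_Mapping.single 0 e * g)
      = (\<Sum>\<alpha>\<in>?A. (c * Poly_Mapping.lookup f \<alpha>) * cnj (e * Poly_Mapping.lookup g \<alpha>)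
          * of_real (H2_weight \<alpha>))"
      by (subst H2_inner_superset[where A = ?A]) (auto simp: in_keys_iff lookup_const_mult)
    also have "\<dots> = H2_inner f g * (c * cnj e)"
      unfolding H2_inner_def sum_distrib_right by (rule sum.cong) (simp_all add: mult_ac)
    finally show ?thesis .
  qed
  then show ?thesis
    by (simp add: H2_vec_inner_def pure_tensor_def sum_distrib_left)
qed

definition monomials :: "('d mpoly ^ 'r) set" where
  "monomials = {pure_tensor (Poly_Mapping.single \<alpha> 1) \<xi> | \<alpha> \<xi>. True}"

text \<open>From here on \<open>mpoly_vec.subspace\<close> is the notion of a submodule over the polynomial ring
  and \<open>mpoly_vec.span\<close> the submodule generated by a set.\<close>

interpretation mpoly_vec:
  module "(*s) :: 'd mpoly \<Rightarrow> 'd mpoly ^ 'r \<Rightarrow> 'd mpoly ^ 'r"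
  by unfold_locales (simp_all add: vec_eq_iff algebra_simps)

definition generated_by_monomials :: "('d mpoly ^ 'r) set \<Rightarrow> bool" where
  "generated_by_monomials M \<longleftrightarrow> (\<exists>S. S \<subseteq> monomials \<and> mpoly_vec.span S = M)"

definition stable_division_with_constant :: "real \<Rightarrow> ('d::finite mpoly ^ 'r) set \<Rightarrow> bool" where
  "stable_division_with_constant C M \<longleftrightarrow>
     (\<exists>F. finite F \<and> F \<subseteq> M \<and> mpoly_vec.span F = M \<and>
       (\<forall>h\<in>M. \<exists>a. h = (\<Sum>f\<in>F. a f *s f) \<and>
          (\<Sum>f\<in>F. (H2_vec_norm (a f *s f))\<^sup>2) \<le> C * (H2_vec_norm h)\<^sup>2))"

definition stable_division_property :: "('d::finite mpoly ^ 'r) set \<Rightarrow> bool" where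
  "stable_division_property M \<longleftrightarrow> (\<exists>C. stable_division_with_constant C M)"

end

theory Submission
  imports Defs
begin

text \<open>A submodule \<open>M\<close> generated by monomials is the direct sum of the spaces \<open>z\<^sup>\<beta> \<otimes> V\<^sub>\<beta>\<close>, where
  \<open>V\<^sub>\<beta> = {\<xi>. z\<^sup>\<beta> \<otimes> \<xi> \<in> M}\<close> grows with \<open>\<beta>\<close> in the divisibility order.  Call \<open>\<alpha>\<close> critical if no
  proper divisor has the same space \<open>V\<^sub>\<alpha>\<close>.  The critical \<open>\<alpha>\<close> with \<open>dim V\<^sub>\<alpha> = k\<close> form an antichain,
  because nested spaces of equal dimension coincide, so by Dickson's lemma there are finitely
  many critical exponents.  Choose an orthonormal basis of \<open>V\<^sub>\<alpha>\<close> for each of them, and let the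
  generators be the monomials \<open>z\<^sup>\<alpha> \<otimes> e\<close>.  Every \<open>\<beta>\<close> has a critical divisor \<open>\<pi>(\<beta>)\<close> with the same
  space; expanding the coefficient of \<open>h\<close> at \<open>\<beta>\<close> in the basis chosen at \<open>\<pi>(\<beta>)\<close> splits \<open>h\<close> into
  mutually orthogonal multiples of the generators, and Parseval's identity gives even equality
  of the norms.\<close>

section \<open>Orthonormal bases of subspaces of the coordinate space\<close>

definition herm :: "complex ^ 'r \<Rightarrow> complex ^ 'r \<Rightarrow> complex" where
  "herm x y = (\<Sum>i\<in>UNIV. x $ i * cnj (y $ i))"

definition orthonormal :: "(complex ^ 'r) set \<Rightarrow> bool" where
  "orthonormal B \<longleftrightarrow> (\<forall>x\<in>B. \<forall>y\<in>B. herm x y = (if x = y then 1 else 0))"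

lemma herm_diff_left: "herm (x - y) z = herm x z - herm y z"
  by (simp add: herm_def algebra_simps sum_subtractf)

lemma herm_scale_left: "herm (c *s x) y = c * herm x y"
  by (simp add: herm_def sum_distrib_left mult_ac)

lemma herm_sum_left: "herm (\<Sum>a\<in>A. f a) y = (\<Sum>a\<in>A. herm (f a) y)"
  by (simp add: herm_def sum_distrib_right sum.swap[where B = A])

lemma herm_commute: "herm y x = cnj (herm x y)"
  by (simp add: herm_def mult.commute)

lemma herm_self: "herm x x = of_real ((norm x)\<^sup>2)"
  by (simp add: herm_def norm_vec_def L2_set_def sum_nonneg flip: complex_norm_square)

lemma norm_complex_scale: "norm (c *s x) = cmod c * norm (x :: complex ^ 'r)"
  by (simp add: norm_vec_def L2_set_def norm_mult power_mult_distrib real_sqrt_mult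
      flip: sum_distrib_left)

lemma orthonormal_norm: "orthonormal B \<Longrightarrow> e \<in> B \<Longrightarrow> norm e = 1"
  using herm_self[of e] power2_eq_1_iff[of "norm e"] norm_ge_zero[of e]
  by (auto simp: orthonormal_def simp del: of_real_power)

lemma herm_orthonormal_sum:
  assumes "orthonormal B" "finite B" "e \<in> B"
  shows "herm (\<Sum>b\<in>B. c b *s b) e = c e"
proof -
  have "herm (\<Sum>b\<in>B. c b *s b) e = (\<Sum>b\<in>B. if b = e then c b else 0)"
    unfolding herm_sum_left herm_scale_left
    using assms(1,3) by (intro sum.cong) (auto simp: orthonormal_def)
  then show ?thesis using assms by simp
qed

text \<open>Pairing a vanishing linear combination with one of its vectors isolates the coefficient
  of that vector.\<close>

lemma orthonormal_independent:
  fixes B :: "(complex ^ 'r) set"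
  assumes "orthonormal B"
  shows "vec.independent B"
  unfolding vec.independent_explicit_finite_subsets
proof (intro allI impI ballI)
  fix A c v
  assume A: "A \<subseteq> B" "finite A" and s: "(\<Sum>x\<in>A. c x *s x) = 0" and v: "v \<in> A"
  have "orthonormal A" using assms A(1) unfolding orthonormal_def by blast
  from herm_orthonormal_sum[OF this A(2) v, of c] show "c v = 0" by (simp add: s herm_def)
qed

text \<open>An orthonormal subset of \<open>V\<close> of greatest cardinality already expands every
  \<open>v\<close> in \<open>V\<close>: otherwise the normalised residual of \<open>v\<close> could
  be adjoined to it.\<close>

lemma orthonormal_basis_exists:
  fixes V :: "(complex ^ 'r) set"
  assumes V: "vec.subspace V"
  obtains B where "finite B" "B \<subseteq> V" "orthonormal B"
    "\<And>v. v \<in> V \<Longrightarrow> (\<Sum>e\<in>B. herm v e *s e) = v"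
proof -
  \<comment> \<open>Both facts come from independence. The strict bound by \<open>Suc\<close> is the
    form that the maximality principle below takes, and finiteness makes the cardinality grow when a
    vector is adjoined.\<close>
  have fin: "finite B" and bound: "card B < Suc (vec.dim V)"
    if "orthonormal B" "B \<subseteq> V" for B
    using orthonormal_independent[OF that(1)] vec.finiteI_independent
      vec.independent_card_le_dim[OF that(2)] by (auto simp: less_Suc_eq_le)
  have "orthonormal ({} :: (complex ^ 'r) set) \<and> {} \<subseteq> V"
    by (simp add: orthonormal_def)
  with bound obtain B where B: "orthonormal B" "B \<subseteq> V"
    and max: "\<And>B'. orthonormal B' \<Longrightarrow> B' \<subseteq> V \<Longrightarrow> card B' \<le> card B"
    using ex_has_greatest_nat[of "\<lambda>B. orthonormal B \<and> B \<subseteq> V" "{}" card "Suc (vec.dim V)"]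
    by blast
  have fB: "finite B" using fin B by blast
  have "(\<Sum>e\<in>B. herm v e *s e) = v" if "v \<in> V" for v
  proof (rule ccontr)
    define w where "w = v - (\<Sum>e\<in>B. herm v e *s e)"
    assume "(\<Sum>e\<in>B. herm v e *s e) \<noteq> v"
    then have w0: "w \<noteq> 0" by (simp add: w_def)
    define u where "u = of_real (inverse (norm w)) *s w"
    have "w \<in> V" unfolding w_def
      using B(2) that by (intro vec.subspace_diff[OF V] vec.subspace_sum[OF V] vec.subspace_scale[OF V]) auto
    then have uV: "u \<in> V" unfolding u_def by (rule vec.subspace_scale[OF V])
    have ue: "herm u e = 0" if "e \<in> B" for e
      using herm_orthonormal_sum[OF B(1) fB that, of "herm v"]
      by (simp add: u_def w_def herm_scale_left herm_diff_left)
    then have eu: "herm e u = 0" if "e \<in> B" for e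
      using that herm_commute[of e u] by simp
    have uu: "herm u u = 1"
      using w0 by (simp add: u_def herm_self norm_complex_scale norm_inverse)
    have "u \<notin> B" using ue uu by force
    moreover have "orthonormal (insert u B)"
      using B(1) ue eu uu by (auto simp: orthonormal_def)
    ultimately show False
      using max[of "insert u B"] uV B(2) fB by auto
  qed
  with fB B show thesis by (intro that) auto
qed

text \<open>Pairing the expansion of \<open>v\<close> with \<open>v\<close> itself turns the term of
  \<open>e\<close> into \<open>herm v e\<close> times its conjugate.\<close>

lemma parseval:
  assumes "(\<Sum>e\<in>B. herm v e *s e) = v"
  shows "(\<Sum>e\<in>B. (cmod (herm v e))\<^sup>2) = (norm v)\<^sup>2"
proof -
  have "complex_of_real ((norm v)\<^sup>2) = herm (\<Sum>e\<in>B. herm v e *s e) v"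
    by (simp add: assms herm_self)
  also have "\<dots> = (\<Sum>e\<in>B. herm v e * cnj (herm v e))"
    unfolding herm_sum_left herm_scale_left by (intro sum.cong refl) (simp flip: herm_commute)
  also have "\<dots> = of_real (\<Sum>e\<in>B. (cmod (herm v e))\<^sup>2)"
    by (simp flip: complex_norm_square)
  finally show ?thesis by (simp only: of_real_eq_iff)
qed

section \<open>Dickson's lemma, via monotone subsequences\<close>

lemma nat_seq_incseq_subseq:
  fixes s :: "nat \<Rightarrow> nat"
  obtains g where "strict_mono g" "incseq (\<lambda>n. s (g n))"
proof -
  obtain g where g: "strict_mono g" "monoseq (\<lambda>n. s (g n))"
    using seq_monosub[of s] by auto
  show thesis
  proof (cases "incseq (\<lambda>n. s (g n))")
    case False
    then have dec: "s (g n) \<le> s (g m)" if "m \<le> n" for m n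
      using g(2) that by (auto simp: monoseq_iff decseq_def)
    \<comment> \<open>The monotone subsequence is nonincreasing in this case, so it is constant from
      an index \<open>k\<close> of its least value on; that tail is also increasing.\<close>
    obtain k where k: "\<And>n. s (g k) \<le> s (g n)"
      using ex_has_least_nat[of "\<lambda>_. True" 0 "\<lambda>n. s (g n)"] by auto
    have "s (g (k + n)) = s (g k)" for n
      using k dec[of k "k + n"] by (simp add: le_antisym)
    then have "incseq (\<lambda>n. s (g (k + n)))" by (simp add: incseq_def)
    moreover have "strict_mono (\<lambda>n. g (k + n))"
      using g(1) by (simp add: strict_mono_def)
    ultimately show thesis by (rule that[rotated])
  qed (use g that in blast)
qed

text \<open>One coordinate is treated at a time: thinning the sequence further for a new coordinate
  keeps the earlier ones increasing.\<close>

lemma incseq_subseq_on_finite: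
  fixes f :: "nat \<Rightarrow> 'd \<Rightarrow> nat"
  assumes "finite J"
  shows "\<exists>g. strict_mono g \<and> (\<forall>j\<in>J. incseq (\<lambda>n. f (g n) j))"
  using assms
proof (induction J)
  case empty
  show ?case using strict_mono_id by auto
next
  case (insert x J)
  then obtain g where g: "strict_mono g" "\<And>j. j \<in> J \<Longrightarrow> incseq (\<lambda>n. f (g n) j)" by auto
  obtain k where k: "strict_mono k" "incseq (\<lambda>n. f (g (k n)) x)"
    using nat_seq_incseq_subseq[of "\<lambda>n. f (g n) x"] .
  have "incseq (\<lambda>n. f (g (k n)) j)" if "j \<in> J" for j
    using g(2)[OF that] strict_mono_less_eq[OF k(1)] by (simp add: incseq_def)
  then show ?case
    using k strict_mono_compose[OF g(1) k(1)] by (intro exI[of _ "\<lambda>n. g (k n)"]) auto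
qed

text \<open>An infinite \<open>S\<close> contains an injective sequence. Along a subsequence that
  increases in every coordinate, the first term divides the second, so the hypothesis makes two
  distinct terms equal.\<close>

lemma dickson:
  fixes S :: "('d::finite \<Rightarrow>\<^sub>0 nat) set"
  assumes "\<And>\<alpha> \<gamma>. \<alpha> \<in> S \<Longrightarrow> \<alpha> + \<gamma> \<in> S \<Longrightarrow> \<gamma> = 0"
  shows "finite S"
proof (rule ccontr)
  assume "infinite S"
  then obtain f :: "nat \<Rightarrow> 'd \<Rightarrow>\<^sub>0 nat" where f: "inj f" "range f \<subseteq> S"
    using infinite_countable_subset by blast
  obtain g where g: "strict_mono g" "\<And>j. incseq (\<lambda>n. Poly_Mapping.lookup (f (g n)) j)"
    using incseq_subseq_on_finite[of UNIV "\<lambda>n. Poly_Mapping.lookup (f n)"] by auto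
  let ?\<alpha> = "f (g 0)" and ?\<beta> = "f (g 1)"
  \<comment> \<open>Subtraction of exponents is truncated, so this identity rests on the
    coordinatewise inequality.\<close>
  have \<beta>: "?\<beta> = ?\<alpha> + (?\<beta> - ?\<alpha>)"
    using g(2) by (intro poly_mapping_eqI) (simp add: lookup_add lookup_minus incseq_def)
  then have "?\<beta> - ?\<alpha> = 0"
    using f(2) by (intro assms[of ?\<alpha>]) (metis rangeI subsetD)+
  with \<beta> have "g 1 = g 0" using f(1) by (simp add: inj_eq)
  moreover have "g 0 < g 1" using g(1) by (simp add: strict_mono_def)
  ultimately show False by simp
qed

section \<open>Coefficient vectors and the norm in terms of them\<close>

abbreviation mon :: "('d \<Rightarrow>\<^sub>0 nat) \<Rightarrow> complex ^ 'r \<Rightarrow> 'd mpoly ^ 'r" where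
  "mon \<alpha> \<xi> \<equiv> pure_tensor (Poly_Mapping.single \<alpha> 1) \<xi>"

definition vcoeff :: "'d mpoly ^ 'r \<Rightarrow> ('d \<Rightarrow>\<^sub>0 nat) \<Rightarrow> complex ^ 'r" where
  "vcoeff h \<beta> = (\<chi> i. Poly_Mapping.lookup (h $ i) \<beta>)"

definition vkeys :: "'d mpoly ^ 'r \<Rightarrow> ('d \<Rightarrow>\<^sub>0 nat) set" where
  "vkeys h = (\<Union>i\<in>UNIV. Poly_Mapping.keys (h $ i))"

lemma finite_vkeys: "finite (vkeys (h :: 'd mpoly ^ 'r))"
  by (simp add: vkeys_def)

lemma vcoeff_eq_0: "\<beta> \<notin> vkeys h \<Longrightarrow> vcoeff h \<beta> = 0"
  by (auto simp: vkeys_def vcoeff_def vec_eq_iff in_keys_iff)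

lemma mpoly_vec_eqI: "(\<And>\<beta>. vcoeff f \<beta> = vcoeff g \<beta>) \<Longrightarrow> f = g"
  by (auto simp: vcoeff_def vec_eq_iff intro: poly_mapping_eqI)

lemma vcoeff_zero [simp]: "vcoeff 0 \<beta> = 0"
  by (simp add: vcoeff_def vec_eq_iff)

lemma vcoeff_add: "vcoeff (f + g) \<beta> = vcoeff f \<beta> + vcoeff g \<beta>"
  by (simp add: vcoeff_def vec_eq_iff lookup_add)

lemma vcoeff_sum: "vcoeff (\<Sum>a\<in>A. f a) \<beta> = (\<Sum>a\<in>A. vcoeff (f a) \<beta>)"
  by (induction A rule: infinite_finite_induct) (simp_all add: vcoeff_add)

lemma vcoeff_pure_tensor: "vcoeff (pure_tensor p \<xi>) \<beta> = Poly_Mapping.lookup p \<beta> *s \<xi>"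
  by (simp add: vcoeff_def pure_tensor_def vec_eq_iff lookup_const_mult mult.commute[of _ "Poly_Mapping.lookup p \<beta>"])

lemma vcoeff_mon: "vcoeff (mon \<alpha> \<xi>) \<beta> = (if \<beta> = \<alpha> then \<xi> else 0)"
  by (auto simp add: vcoeff_pure_tensor lookup_single)

lemma scale_pure_tensor: "p *s pure_tensor q \<xi> = pure_tensor (p * q) \<xi>"
  by (simp add: pure_tensor_def vec_eq_iff mult_ac)

lemma single_scale_mon:
  "Poly_Mapping.single \<gamma> c *s mon \<alpha> \<xi> = mon (\<alpha> + \<gamma>) (c *s \<xi>)"
  by (rule mpoly_vec_eqI)
    (simp add: scale_pure_tensor mult_single vcoeff_pure_tensor lookup_single add.commute when_def)

lemma mon_expansion:
  assumes "finite K" "vkeys h \<subseteq> K"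
  shows "(\<Sum>\<beta>\<in>K. mon \<beta> (vcoeff h \<beta>)) = h"
proof (rule mpoly_vec_eqI)
  fix \<beta>
  show "vcoeff (\<Sum>\<beta>\<in>K. mon \<beta> (vcoeff h \<beta>)) \<beta> = vcoeff h \<beta>"
    using assms vcoeff_eq_0[of \<beta> h] by (auto simp: vcoeff_sum vcoeff_mon)
qed

lemma H2_weight_nonneg: "H2_weight \<beta> \<ge> 0"
  by (simp add: H2_weight_def prod_nonneg)

text \<open>Components at distinct exponents are orthogonal. The set \<open>K\<close> may exceed the
  support, so that the formula applies both to \<open>h\<close> and to the multiples of single
  generators.\<close>

lemma H2_vec_norm_power2:
  fixes h :: "'d::finite mpoly ^ 'r"
  assumes K: "finite K" "\<And>\<beta>. \<beta> \<notin> K \<Longrightarrow> vcoeff h \<beta> = 0"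
  shows "(H2_vec_norm h)\<^sup>2 = (\<Sum>\<beta>\<in>K. H2_weight \<beta> * (norm (vcoeff h \<beta>))\<^sup>2)"
proof -
  have "Poly_Mapping.keys (h $ i) \<inter> Poly_Mapping.keys (h $ i) \<subseteq> K" for i
    using K(2) by (force simp: vcoeff_def vec_eq_iff in_keys_iff)
  then have "H2_vec_inner h h = (\<Sum>i\<in>UNIV. \<Sum>\<beta>\<in>K. Poly_Mapping.lookup (h $ i) \<beta> *
      cnj (Poly_Mapping.lookup (h $ i) \<beta>) * of_real (H2_weight \<beta>))"
    unfolding H2_vec_inner_def using K(1) by (intro sum.cong refl H2_inner_superset)
  also have "\<dots> = (\<Sum>\<beta>\<in>K. of_real (H2_weight \<beta>) * herm (vcoeff h \<beta>) (vcoeff h \<beta>))"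
    unfolding herm_def vcoeff_def
    by (subst sum.swap) (simp add: sum_distrib_left mult_ac)
  also have "\<dots> = of_real (\<Sum>\<beta>\<in>K. H2_weight \<beta> * (norm (vcoeff h \<beta>))\<^sup>2)"
    by (simp add: herm_self)
  finally have "H2_vec_inner h h = of_real (\<Sum>\<beta>\<in>K. H2_weight \<beta> * (norm (vcoeff h \<beta>))\<^sup>2)" .
  then show ?thesis
    by (simp add: H2_vec_norm_def H2_weight_nonneg sum_nonneg del: of_real_sum)
qed

section \<open>Fibres of a submodule over the exponents\<close>

definition fibre :: "('d mpoly ^ 'r) set \<Rightarrow> ('d \<Rightarrow>\<^sub>0 nat) \<Rightarrow> (complex ^ 'r) set" where
  "fibre M \<beta> = {\<xi>. mon \<beta> \<xi> \<in> M}"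

context
  fixes M :: "('d mpoly ^ 'r) set"
  assumes M: "mpoly_vec.subspace M"
begin

text \<open>Multiplication by the term with coefficient \<open>c\<close> and exponent
  \<open>\<gamma>\<close>. The case \<open>c = 1\<close> gives monotonicity of the fibres, the case
  \<open>\<gamma> = 0\<close> their closure under scalars.\<close>

lemma fibre_shift: "\<xi> \<in> fibre M \<alpha> \<Longrightarrow> c *s \<xi> \<in> fibre M (\<alpha> + \<gamma>)"
  unfolding fibre_def
  using mpoly_vec.subspace_scale[OF M, of "mon \<alpha> \<xi>" "Poly_Mapping.single \<gamma> c"]
  by (simp add: single_scale_mon)

lemma fibre_mono: "fibre M \<alpha> \<subseteq> fibre M (\<alpha> + \<gamma>)"
  using fibre_shift[of _ _ 1] by auto

lemma subspace_fibre: "vec.subspace (fibre M \<beta>)"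
proof -
  have "mon \<beta> 0 = (0 :: 'd mpoly ^ 'r)"
    and "mon \<beta> (\<xi> + \<eta>) = mon \<beta> \<xi> + (mon \<beta> \<eta> :: 'd mpoly ^ 'r)" for \<xi> \<eta>
    by (auto intro!: mpoly_vec_eqI simp: vcoeff_add vcoeff_mon)
  then show ?thesis
    using fibre_shift[of _ \<beta> _ 0] mpoly_vec.subspace_0[OF M] mpoly_vec.subspace_add[OF M]
    by (auto simp: vec.subspace_def fibre_def)
qed

text \<open>Here generation by monomials enters. A multiple of a generator
  \<open>mon \<alpha> \<xi>\<close> has at \<open>\<beta>\<close> a scalar multiple of
  \<open>\<xi>\<close>, which is zero unless \<alpha> divides \<beta>; so \<open>fibre_shift\<close>
  applies, and sums stay in the fibre because it is a subspace.\<close>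

lemma vcoeff_in_fibre:
  assumes "generated_by_monomials M" "h \<in> M"
  shows "vcoeff h \<beta> \<in> fibre M \<beta>"
proof -
  obtain S where S: "S \<subseteq> monomials" "mpoly_vec.span S = M"
    using assms(1) by (auto simp: generated_by_monomials_def)
  have "h \<in> mpoly_vec.span S" using S assms by simp
  then show ?thesis
  proof (induction arbitrary: \<beta> rule: mpoly_vec.span_induct_alt)
    case base
    show ?case by (simp add: vec.subspace_0[OF subspace_fibre])
  next
    case (step p x y)
    obtain \<alpha> \<xi> where x: "x = mon \<alpha> \<xi>" using step S by (auto simp: monomials_def)
    have \<xi>: "\<xi> \<in> fibre M \<alpha>" using step(1) S x mpoly_vec.span_base by (auto simp: fibre_def)
    have "vcoeff (p *s x) \<beta> \<in> fibre M \<beta>"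
    proof (cases "\<beta> \<in> Poly_Mapping.keys (p * Poly_Mapping.single \<alpha> 1)")
      case True
      then obtain \<gamma> where "\<beta> = \<alpha> + \<gamma>"
        using keys_mult[of p "Poly_Mapping.single \<alpha> 1"] by (auto simp: add.commute)
      then show ?thesis
        using fibre_shift[OF \<xi>] by (simp add: x scale_pure_tensor vcoeff_pure_tensor)
    next
      case False
      then show ?thesis
        by (simp add: x scale_pure_tensor vcoeff_pure_tensor in_keys_iff
            vec.subspace_0[OF subspace_fibre])
    qed
    then show ?case
      using step by (simp add: vcoeff_add vec.subspace_add[OF subspace_fibre])
  qed
qed

end

section \<open>Critical exponents and their finiteness\<close>

definition critical :: "(('d \<Rightarrow>\<^sub>0 nat) \<Rightarrow> 'a) \<Rightarrow> ('d \<Rightarrow>\<^sub>0 nat) set" where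
  "critical V = {\<alpha>. \<forall>\<alpha>' \<gamma>. \<alpha> = \<alpha>' + \<gamma> \<longrightarrow> V \<alpha>' = V \<alpha> \<longrightarrow> \<gamma> = 0}"

text \<open>Induction on the total degree: an exponent that is not critical has a proper divisor
  with the same value of \<open>V\<close>, and that divisor has smaller degree.\<close>

lemma critical_below:
  fixes \<beta> :: "'d::finite \<Rightarrow>\<^sub>0 nat"
  shows "\<exists>\<alpha>\<in>critical V. \<exists>\<delta>. \<beta> = \<alpha> + \<delta> \<and> V \<alpha> = V \<beta>"
proof (induction "\<Sum>j\<in>UNIV. Poly_Mapping.lookup \<beta> j" arbitrary: \<beta> rule: less_induct)
  case less
  show ?case
  proof (cases "\<beta> \<in> critical V")
    case True
    then show ?thesis by (intro bexI[of _ \<beta>] exI[of _ 0]) auto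
  next
    case False
    then have "\<exists>\<alpha> \<gamma>. \<beta> = \<alpha> + \<gamma> \<and> V \<alpha> = V \<beta> \<and> \<gamma> \<noteq> 0"
      unfolding critical_def mem_Collect_eq not_all not_imp .
    then obtain \<alpha> \<gamma> where \<beta>: "\<beta> = \<alpha> + \<gamma>" "V \<alpha> = V \<beta>" "\<gamma> \<noteq> 0"
      by (elim exE conjE)
    from \<beta>(3) obtain j where "Poly_Mapping.lookup \<gamma> j \<noteq> 0"
      using poly_mapping_eqI[of \<gamma> 0] by auto
    then have "(\<Sum>j\<in>UNIV. Poly_Mapping.lookup \<gamma> j) > 0"
      by (intro sum_pos2[of _ j]) auto
    then have "(\<Sum>j\<in>UNIV. Poly_Mapping.lookup \<alpha> j) < (\<Sum>j\<in>UNIV. Poly_Mapping.lookup \<beta> j)"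
      by (simp add: \<beta>(1) lookup_add sum.distrib)
    from less[OF this] obtain \<alpha>' \<delta> where "\<alpha>' \<in> critical V" "\<alpha> = \<alpha>' + \<delta>" "V \<alpha>' = V \<alpha>" by blast
    then show ?thesis
      using \<beta>(1,2) by (intro bexI[of _ \<alpha>'] exI[of _ "\<delta> + \<gamma>"]) (simp_all only: add.assoc)
  qed
qed

lemma finite_critical_fibre:
  fixes M :: "('d::finite mpoly ^ 'r) set"
  assumes M: "mpoly_vec.subspace M"
  shows "finite (critical (fibre M))"
proof -
  have "finite {\<alpha> \<in> critical (fibre M). vec.dim (fibre M \<alpha>) = k}" for k
  proof (rule dickson)
    fix \<alpha> \<gamma>
    assume "\<alpha> \<in> {\<alpha> \<in> critical (fibre M). vec.dim (fibre M \<alpha>) = k}"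
      and "\<alpha> + \<gamma> \<in> {\<alpha> \<in> critical (fibre M). vec.dim (fibre M \<alpha>) = k}"
    then have c: "\<alpha> + \<gamma> \<in> critical (fibre M)"
      and d: "vec.dim (fibre M (\<alpha> + \<gamma>)) \<le> vec.dim (fibre M \<alpha>)" by auto
    have "fibre M \<alpha> = fibre M (\<alpha> + \<gamma>)"
      using vec.subspace_dim_equal[OF subspace_fibre[OF M] subspace_fibre[OF M] fibre_mono[OF M] d] .
    with c show "\<gamma> = 0" by (auto simp: critical_def)
  qed
  \<comment> \<open>Dimensions are bounded by that of the whole space, so finitely many of these
    finite classes cover all critical exponents.\<close>
  then have "finite (\<Union>k\<in>{..vec.dim (UNIV :: (complex ^ 'r) set)}.
      {\<alpha> \<in> critical (fibre M). vec.dim (fibre M \<alpha>) = k})" by blast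
  then show ?thesis
    by (rule rev_finite_subset) (auto simp del: vec.dim_UNIV intro: vec.dim_subset)
qed

section \<open>Generators and the division with constant 1\<close>

text \<open>Exchanges summation by generator with summation by exponent, where \<open>\<pi>\<close>
  assigns \<beta> to a class with its own basis. It is used once for the terms of \<open>h\<close>
  and once for their squared norms.\<close>

lemma sum_Sigma_group:
  assumes "finite K" "finite A" "\<pi> ` K \<subseteq> A" "\<And>\<alpha>. finite (B \<alpha>)"
  shows "(\<Sum>(\<alpha>, e)\<in>Sigma A B. \<Sum>\<beta>\<in>{\<beta>\<in>K. \<pi> \<beta> = \<alpha>}. X \<beta> e) = (\<Sum>\<beta>\<in>K. \<Sum>e\<in>B (\<pi> \<beta>). X \<beta> e)"
proof -
  have "(\<Sum>(\<alpha>, e)\<in>Sigma A B. \<Sum>\<beta>\<in>{\<beta>\<in>K. \<pi> \<beta> = \<alpha>}. X \<beta> e)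
      = (\<Sum>\<alpha>\<in>A. \<Sum>e\<in>B \<alpha>. \<Sum>\<beta>\<in>{\<beta>\<in>K. \<pi> \<beta> = \<alpha>}. X \<beta> e)"
    using assms by (intro sum.Sigma[symmetric]) auto
  also have "\<dots> = (\<Sum>\<alpha>\<in>A. \<Sum>\<beta>\<in>{\<beta>\<in>K. \<pi> \<beta> = \<alpha>}. \<Sum>e\<in>B (\<pi> \<beta>). X \<beta> e)"
    by (intro sum.cong refl, subst sum.swap) (auto intro: sum.cong)
  also have "\<dots> = (\<Sum>\<beta>\<in>K. \<Sum>e\<in>B (\<pi> \<beta>). X \<beta> e)"
    using assms by (intro sum.group)
  finally show ?thesis .
qed

lemma stable_division_one:
  fixes M :: "('d::finite mpoly ^ 'r) set"
  assumes M: "mpoly_vec.subspace M" and gen: "generated_by_monomials M"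
  shows "stable_division_with_constant 1 M"
proof -
  define A where "A = critical (fibre M)"
  have finA: "finite A" unfolding A_def by (rule finite_critical_fibre[OF M])
  \<comment> \<open>Divisor and quotient form one pair, so that a single choice yields matching
    functions \<open>\<pi>\<close> and \<open>\<delta>\<close>.\<close>
  have "\<forall>\<beta>. \<exists>p. fst p \<in> A \<and> \<beta> = fst p + snd p \<and> fibre M (fst p) = fibre M \<beta>"
    using critical_below[of "fibre M"] unfolding A_def by fastforce
  from choice[OF this] obtain p where p: "\<And>\<beta>. fst (p \<beta>) \<in> A"
    "\<And>\<beta>. \<beta> = fst (p \<beta>) + snd (p \<beta>)" "\<And>\<beta>. fibre M (fst (p \<beta>)) = fibre M \<beta>" by blast
  define \<pi> \<delta> where "\<pi> \<beta> = fst (p \<beta>)" and "\<delta> \<beta> = snd (p \<beta>)" for \<beta>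
  have \<pi>: "\<pi> \<beta> \<in> A" "\<beta> = \<pi> \<beta> + \<delta> \<beta>" "fibre M (\<pi> \<beta>) = fibre M \<beta>" for \<beta>
    unfolding \<pi>_def \<delta>_def by (rule p)+
  have "\<forall>\<alpha>. \<exists>B. finite B \<and> B \<subseteq> fibre M \<alpha> \<and> orthonormal B \<and>
      (\<forall>v\<in>fibre M \<alpha>. (\<Sum>e\<in>B. herm v e *s e) = v)"
  proof
    fix \<alpha>
    show "\<exists>B. finite B \<and> B \<subseteq> fibre M \<alpha> \<and> orthonormal B \<and>
        (\<forall>v\<in>fibre M \<alpha>. (\<Sum>e\<in>B. herm v e *s e) = v)"
      by (rule orthonormal_basis_exists[OF subspace_fibre[OF M, of \<alpha>]]) (intro exI conjI ballI)
  qed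
  from choice[OF this] obtain B where B: "\<And>\<alpha>. finite (B \<alpha>)" "\<And>\<alpha>. B \<alpha> \<subseteq> fibre M \<alpha>"
    "\<And>\<alpha>. orthonormal (B \<alpha>)" "\<And>\<alpha> v. v \<in> fibre M \<alpha> \<Longrightarrow> (\<Sum>e\<in>B \<alpha>. herm v e *s e) = v"
    by blast
  define I where "I = Sigma A B"
  define F where "F = (\<lambda>(\<alpha>, e). mon \<alpha> e) ` I"
  have unit: "norm e = 1" if "e \<in> B \<alpha>" for \<alpha> e
    using orthonormal_norm[OF B(3) that] .
  \<comment> \<open>The division property sums over the set \<open>F\<close>, whereas the
    computation runs over pairs. Unit vectors are nonzero, so a generator determines its exponent
    and its vector.\<close>
  have inj: "inj_on (\<lambda>(\<alpha>, e). mon \<alpha> e) I"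
  proof (rule inj_onI, clarify)
    fix \<alpha> e \<alpha>' e'
    assume "(\<alpha>, e) \<in> I" "(\<alpha>', e') \<in> I" and eq: "mon \<alpha> e = mon \<alpha>' e'"
    then have "e \<noteq> 0" using unit by (force simp: I_def)
    then show "\<alpha> = \<alpha>' \<and> e = e'"
      using arg_cong[OF eq, of "\<lambda>h. vcoeff h \<alpha>"] by (auto simp: vcoeff_mon split: if_splits)
  qed
  have finF: "finite F" and FM: "F \<subseteq> M"
    using finA B(1,2) by (auto simp: F_def I_def fibre_def)
  have division: "\<exists>a. h = (\<Sum>f\<in>F. a f *s f) \<and> (\<Sum>f\<in>F. (H2_vec_norm (a f *s f))\<^sup>2) = (H2_vec_norm h)\<^sup>2"
    if h: "h \<in> M" for h
  proof -
    define K where "K = vkeys h"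
    have K: "finite K" unfolding K_def by (rule finite_vkeys)
    define c where "c \<beta> e = herm (vcoeff h \<beta>) e" for \<beta> e
    \<comment> \<open>The coefficient lies in the fibre at \<beta>, which equals the fibre at
      \<open>\<pi> \<beta>\<close>; hence the basis chosen there expands it.\<close>
    have exp: "(\<Sum>e\<in>B (\<pi> \<beta>). c \<beta> e *s e) = vcoeff h \<beta>" for \<beta>
      unfolding c_def using vcoeff_in_fibre[OF M gen h, of \<beta>] by (intro B(4)) (simp add: \<pi>(3))
    \<comment> \<open>The multiplier of the generator \<open>(\<alpha>, e)\<close> collects all
      \<beta> assigned to \<alpha>; the factor with exponent \<open>\<delta> \<beta>\<close> moves
      \<alpha> to \<beta>.\<close>
    define a where "a = (\<lambda>(\<alpha>, e). \<Sum>\<beta>\<in>{\<beta>\<in>K. \<pi> \<beta> = \<alpha>}. Poly_Mapping.single (\<delta> \<beta>) (c \<beta> e))"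
    define t where "t = (\<lambda>(\<alpha>, e). a (\<alpha>, e) *s mon \<alpha> e)"
    have t: "t (\<alpha>, e) = (\<Sum>\<beta>\<in>{\<beta>\<in>K. \<pi> \<beta> = \<alpha>}. mon \<beta> (c \<beta> e *s e))" for \<alpha> e
      using \<pi>(2) by (auto simp: t_def a_def mpoly_vec.scale_sum_left single_scale_mon intro!: sum.cong)
    have "(\<Sum>i\<in>I. t i) = (\<Sum>(\<alpha>, e)\<in>Sigma A B. \<Sum>\<beta>\<in>{\<beta>\<in>K. \<pi> \<beta> = \<alpha>}. mon \<beta> (c \<beta> e *s e))"
      unfolding I_def by (intro sum.cong) (auto simp: t)
    also have "\<dots> = (\<Sum>\<beta>\<in>K. \<Sum>e\<in>B (\<pi> \<beta>). mon \<beta> (c \<beta> e *s e))"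
      using K finA \<pi>(1) B(1) by (intro sum_Sigma_group) auto
    also have "\<dots> = (\<Sum>\<beta>\<in>K. mon \<beta> (vcoeff h \<beta>))"
      by (intro sum.cong refl mpoly_vec_eqI) (simp add: vcoeff_sum vcoeff_mon exp)
    also have "\<dots> = h" using K by (intro mon_expansion) (auto simp: K_def)
    finally have sum_t: "(\<Sum>i\<in>I. t i) = h" .
    \<comment> \<open>The terms of \<open>t (\<alpha>, e)\<close> sit at distinct exponents and
      \<open>e\<close> is a unit vector, so only the moduli of the \<open>c \<beta> e\<close>
      remain.\<close>
    have norm_t: "(H2_vec_norm (t (\<alpha>, e)))\<^sup>2
        = (\<Sum>\<beta>\<in>{\<beta>\<in>K. \<pi> \<beta> = \<alpha>}. H2_weight \<beta> * (cmod (c \<beta> e))\<^sup>2)" if "e \<in> B \<alpha>" for \<alpha> e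
    proof -
      have v: "vcoeff (t (\<alpha>, e)) \<beta> = (if \<beta> \<in> {\<beta>\<in>K. \<pi> \<beta> = \<alpha>} then c \<beta> e *s e else 0)" for \<beta>
        using K unfolding t vcoeff_sum vcoeff_mon by (subst sum.delta') auto
      have "(norm (c \<beta> e *s e))\<^sup>2 = (cmod (c \<beta> e))\<^sup>2" for \<beta>
        by (simp add: norm_complex_scale unit[OF that])
      then show ?thesis
        using K by (subst H2_vec_norm_power2[of "{\<beta>\<in>K. \<pi> \<beta> = \<alpha>}"]) (auto simp: v intro!: sum.cong)
    qed
    have "(\<Sum>i\<in>I. (H2_vec_norm (t i))\<^sup>2)
        = (\<Sum>(\<alpha>, e)\<in>Sigma A B. \<Sum>\<beta>\<in>{\<beta>\<in>K. \<pi> \<beta> = \<alpha>}. H2_weight \<beta> * (cmod (c \<beta> e))\<^sup>2)"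
      unfolding I_def by (intro sum.cong) (auto simp: norm_t)
    also have "\<dots> = (\<Sum>\<beta>\<in>K. \<Sum>e\<in>B (\<pi> \<beta>). H2_weight \<beta> * (cmod (c \<beta> e))\<^sup>2)"
      using K finA \<pi>(1) B(1) by (intro sum_Sigma_group) auto
    also have "\<dots> = (\<Sum>\<beta>\<in>K. H2_weight \<beta> * (norm (vcoeff h \<beta>))\<^sup>2)"
      using parseval[OF exp[unfolded c_def]] by (simp add: c_def flip: sum_distrib_left)
    also have "\<dots> = (H2_vec_norm h)\<^sup>2"
      using K by (intro H2_vec_norm_power2[symmetric]) (auto simp: K_def vcoeff_eq_0)
    finally have norm_sum: "(\<Sum>i\<in>I. (H2_vec_norm (t i))\<^sup>2) = (H2_vec_norm h)\<^sup>2" .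
    let ?mon = "\<lambda>(\<alpha>, e). mon \<alpha> e"
    \<comment> \<open>The multipliers are carried from pairs to elements of \<open>F\<close> along
      the inverse of the injection.\<close>
    define a' where "a' f = a (the_inv_into I ?mon f)" for f
    have a': "a' (?mon i) *s ?mon i = t i" if "i \<in> I" for i
      unfolding a'_def the_inv_into_f_f[OF inj that] by (simp add: t_def split: prod.split)
    have "(\<Sum>f\<in>F. a' f *s f) = (\<Sum>i\<in>I. t i)"
      unfolding F_def sum.reindex[OF inj] o_def by (intro sum.cong refl a')
    moreover have "(\<Sum>f\<in>F. (H2_vec_norm (a' f *s f))\<^sup>2) = (\<Sum>i\<in>I. (H2_vec_norm (t i))\<^sup>2)"
      unfolding F_def sum.reindex[OF inj] o_def by (intro sum.cong refl) (simp only: a')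
    ultimately have "h = (\<Sum>f\<in>F. a' f *s f) \<and>
        (\<Sum>f\<in>F. (H2_vec_norm (a' f *s f))\<^sup>2) = (H2_vec_norm h)\<^sup>2"
      by (simp only: sum_t norm_sum)
    then show ?thesis by (rule exI[of _ a'])
  qed
  have "mpoly_vec.span F = M"
  proof
    show "mpoly_vec.span F \<subseteq> M" by (rule mpoly_vec.span_minimal[OF FM M])
    show "M \<subseteq> mpoly_vec.span F"
    proof
      fix h assume "h \<in> M"
      from division[OF this] obtain a where "h = (\<Sum>f\<in>F. a f *s f)" by blast
      also have "\<dots> \<in> mpoly_vec.span F"
        by (intro mpoly_vec.span_sum mpoly_vec.span_scale mpoly_vec.span_base)
      finally show "h \<in> mpoly_vec.span F" .
    qed
  qed
  moreover have "\<exists>a. h = (\<Sum>f\<in>F. a f *s f) \<and>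
      (\<Sum>f\<in>F. (H2_vec_norm (a f *s f))\<^sup>2) \<le> 1 * (H2_vec_norm h)\<^sup>2" if h: "h \<in> M" for h
  proof -
    obtain a where a: "h = (\<Sum>f\<in>F. a f *s f)"
      "(\<Sum>f\<in>F. (H2_vec_norm (a f *s f))\<^sup>2) = (H2_vec_norm h)\<^sup>2"
      using division[OF h] by (elim exE conjE)
    show ?thesis
      by (rule exI[of _ a], rule conjI, rule a(1)) (simp only: a(2) mult_1 order_refl)
  qed
  ultimately show ?thesis
    unfolding stable_division_with_constant_def
    by (intro exI[of _ F] conjI ballI finF FM)
qed

theorem proposition2p2:
  fixes M :: "('d::finite mpoly ^ 'r::finite) set"
  assumes "mpoly_vec.subspace M"
    and "generated_by_monomials M"
  shows "stable_division_property M \<and> stable_division_with_constant 1 M"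
  using stable_division_one[OF assms] by (auto simp: stable_division_property_def)

end
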